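(* Let $\{F^1_t\}_{t\ge0}$ and $\{F^2_t\}_{t\ge0}$ be one-dimensional symmetric nice Feller processes with symbols $q_1(x,\xi)$ and $q_2(x,\xi)$ and Lévy measures $\nu_1(x,dy)$ and $\nu_2(x,dy)$, respectively. Put $N_1(x,y):=\nu_1(x,(y,\infty))$ and $N_2(x,y):=\nu_2(x,(y,\infty))$ for $x\in\mathbb{R}$ and $y\ge0$. Assume that $N_1$ has a bigger tail than $N_2$ uniformly in $x$, i.e. there is $y_1>0$ such that $N_1(x,y)\ge N_2(x,y)$ for all $x\in\mathbb{R}$ and all $y\ge y_1$. Then, for arbitrary $\rho>0$, $$\int_\rho^\infty\left(\sup_{x\in\mathbb{R}}\int_0^r yN_1(x,y)\,dy\right)^{-1}dr=\infty\quad\text{implies}\quad\int_\rho^\infty\left(\sup_{x\in\mathbb{R}}\int_0^r yN_2(x,y)\,dy\right)^{-1}dr=\infty.$$ In addition, if $\inf_{x\in\mathbb{R}}\int_{y_0}^\infty yN_1(x,y)\,dy>0$ for some $y_0>0$, then, for arbitrary $\rho>0$, $$\int_\rho^\infty\left(\inf_{x\in\mathbb{R}}\int_0^r yN_2(x,y)\,dy\right)^{-1}dr<\infty\quad\text{implies}\quad\int_\rho^\infty\left(\inf_{x\in\mathbb{R}}\int_0^r yN_1(x,y)\,dy\right)^{-1}dr<\infty.$$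
   Context: A Feller process $\{F_t\}_{t\ge0}$ on $\mathbb{R}$ is a Markov process with state space $(\mathbb{R},\mathcal{B}(\mathbb{R}))$, with laws $\mathbb{P}^x$ and expectations $\mathbb{E}^x$, whose semigroup $P_tf(x)=\mathbb{E}^x[f(F_t)]$ maps $C_\infty(\mathbb{R})$ (continuous functions vanishing at infinity, with the supremum norm) into itself and is strongly continuous there; it is strong Markov with càdlàg paths. Let $(\mathcal{A},\mathcal{D}_{\mathcal{A}})$ be its generator. Condition (C1): $C_c^\infty(\mathbb{R})\subseteq\mathcal{D}_{\mathcal{A}}$; then for $f\in C_c^\infty(\mathbb{R})$, $\mathcal{A}f(x)=-\int_{\mathbb{R}}q(x,\xi)e^{i\xi x}\hat f(\xi)\,d\xi$, $\hat f(\xi)=(2\pi)^{-1}\int e^{-i\xi x}f(x)\,dx$, where the symbol $q$ has a Lévy-Khintchine representation $q(x,\xi)=a(x)-i\xi b(x)+\frac12c(x)\xi^2-\int_{\mathbb{R}}(e^{i\xi y}-1-i\xi y1_{\{|y|\le1\}})\nu(x,dy)$, with $a,c\ge0$ and $b$ real-valued Borel functions and $\nu(x,dy)$ a Borel kernel (the Lévy measure) with $\nu(x,\{0\})=0$, $\int\min\{1,y^2\}\nu(x,dy)<\infty$. Condition (C2): for some $C\ge0$, $\sup_x|q(x,\xi)|\le C(1+\xi^2)$ for all $\xi$; equivalently $a$, $b$, $c$ and $x\mapsto\int\min\{1,y^2\}\nu(x,dy)$ are bounded. Condition (C3): $q(x,0)=a(x)=0$ for all $x$. For a $\sigma$-finite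 measure $\varphi$ the process is $\varphi$-irreducible if $\varphi(B)>0$ implies $\int_0^\infty\mathbb{P}^x(F_t\in B)\,dt>0$ for all $x$; then there is a maximal irreducibility measure $\psi$ (the process is $\bar\varphi$-irreducible iff $\bar\varphi\ll\psi$). Condition (C4): the process is irreducible and $\psi(O)>0$ for every nonempty open $O\subseteq\mathbb{R}$. A nice Feller process is a Feller process satisfying (C1)-(C4). It is symmetric if $q=\operatorname{Re}q$, i.e. $b=0$ and each $\nu(x,dy)$ is a symmetric measure. Convention: $1/0=\infty$ in integrands. *)

theory Defs
  imports "HOL-Probability.Probability"
begin

definition C_infty :: "(real \<Rightarrow> real) set" where
  "C_infty = {f. continuous_on UNIV f \<and> (f \<longlongrightarrow> 0) at_infinity}"

definition Cc_smooth :: "(real \<Rightarrow> real) set" where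
  "Cc_smooth = {f. (\<forall>n. (deriv ^^ n) f differentiable_on UNIV) \<and> compact (closure {x. f x \<noteq> 0})}"

text \<open>
  A process is given by a measurable space \<open>M\<close> (only its carrier and its sigma-algebra matter),
  laws \<open>P x\<close> on \<open>M\<close>, and random variables \<open>F t\<close>; only times \<open>t \<ge> 0\<close> are ever used.
  The natural filtration is indexed by extended times, so that stopping times
  may be infinite; at \<open>\<infinity>\<close> it is generated by the whole process.
\<close>

definition natural_filtration :: "'w measure \<Rightarrow> (real \<Rightarrow> 'w \<Rightarrow> real) \<Rightarrow> ennreal \<Rightarrow> 'w measure" where
  "natural_filtration M F t =
     sigma (space M) {F s -` B \<inter> space M |s B. 0 \<le> s \<and> ennreal s \<le> t \<and> B \<in> sets borel}"

definition transition :: "(real \<Rightarrow> 'w measure) \<Rightarrow> (real \<Rightarrow> 'w \<Rightarrow> real) \<Rightarrow> real \<Rightarrow> real \<Rightarrow> real set \<Rightarrow> real" where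
  "transition P F t x B = measure (P x) {\<omega> \<in> space (P x). F t \<omega> \<in> B}"

definition semigroup_op :: "(real \<Rightarrow> 'w measure) \<Rightarrow> (real \<Rightarrow> 'w \<Rightarrow> real) \<Rightarrow> real \<Rightarrow> (real \<Rightarrow> real) \<Rightarrow> real \<Rightarrow> real" where
  "semigroup_op P F t f x = (LINT \<omega>|P x. f (F t \<omega>))"

locale markov_process =
  fixes M :: "'w measure" and P :: "real \<Rightarrow> 'w measure" and F :: "real \<Rightarrow> 'w \<Rightarrow> real"
  assumes sets_P: "\<And>x. sets (P x) = sets M"
    and prob_space_P: "\<And>x. prob_space (P x)"
    and measurable_F: "\<And>t. t \<ge> 0 \<Longrightarrow> F t \<in> borel_measurable M"
    and measurable_transition:
      "\<And>t B. t \<ge> 0 \<Longrightarrow> B \<in> sets borel \<Longrightarrow> (\<lambda>x. transition P F t x B) \<in> borel_measurable borel"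
    and start: "\<And>x. AE \<omega> in P x. F 0 \<omega> = x"
    and markov: "\<And>x s t B. s \<ge> 0 \<Longrightarrow> t \<ge> 0 \<Longrightarrow> B \<in> sets borel \<Longrightarrow>
      AE \<omega> in P x. real_cond_exp (P x) (natural_filtration M F (ennreal t))
        (\<lambda>\<omega>'. indicator B (F (t + s) \<omega>')) \<omega> = transition P F s (F t \<omega>) B"

text \<open>
  In the strong Markov property the event is restricted to \<open>\<tau> < \<infinity>\<close>, where \<open>enn2real\<close> is faithful.
\<close>

locale feller_process = markov_process M P F
  for M :: "'w measure" and P F +
  assumes feller: "\<And>t f. t \<ge> 0 \<Longrightarrow> f \<in> C_infty \<Longrightarrow> semigroup_op P F t f \<in> C_infty"
    and strongly_continuous:
      "\<And>f. f \<in> C_infty \<Longrightarrow> uniform_limit UNIV (\<lambda>t. semigroup_op P F t f) f (at_right 0)"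
    and right_continuous:
      "\<And>\<omega> t. \<omega> \<in> space M \<Longrightarrow> t \<ge> 0 \<Longrightarrow> ((\<lambda>s. F s \<omega>) \<longlongrightarrow> F t \<omega>) (at_right t)"
    and left_limits:
      "\<And>\<omega> t. \<omega> \<in> space M \<Longrightarrow> t > 0 \<Longrightarrow> \<exists>l. ((\<lambda>s. F s \<omega>) \<longlongrightarrow> l) (at_left t)"
    and strong_markov:
      "\<And>x s \<tau> B. s \<ge> 0 \<Longrightarrow> B \<in> sets borel \<Longrightarrow> stopping_time (natural_filtration M F) \<tau> \<Longrightarrow>
        AE \<omega> in P x. \<tau> \<omega> < \<infinity> \<longrightarrow>
          real_cond_exp (P x) (filtration.pre_sigma (space M) (natural_filtration M F) \<tau>)
            (\<lambda>\<omega>'. if \<tau> \<omega>' < \<infinity> then indicator B (F (enn2real (\<tau> \<omega>') + s) \<omega>') else 0) \<omega>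
          = transition P F s (F (enn2real (\<tau> \<omega>)) \<omega>) B"

text \<open>Convergence in the supremum norm is uniform convergence on \<open>UNIV\<close>.\<close>

definition generator_graph ::
  "(real \<Rightarrow> 'w measure) \<Rightarrow> (real \<Rightarrow> 'w \<Rightarrow> real) \<Rightarrow> (real \<Rightarrow> real) \<Rightarrow> (real \<Rightarrow> real) \<Rightarrow> bool" where
  "generator_graph P F f g \<longleftrightarrow> f \<in> C_infty \<and> g \<in> C_infty \<and>
     uniform_limit UNIV (\<lambda>t x. (semigroup_op P F t f x - f x) / t) g (at_right 0)"

definition generator_domain :: "(real \<Rightarrow> 'w measure) \<Rightarrow> (real \<Rightarrow> 'w \<Rightarrow> real) \<Rightarrow> (real \<Rightarrow> real) set" where
  "generator_domain P F = {f. \<exists>g. generator_graph P F f g}"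

definition generator ::
  "(real \<Rightarrow> 'w measure) \<Rightarrow> (real \<Rightarrow> 'w \<Rightarrow> real) \<Rightarrow> (real \<Rightarrow> real) \<Rightarrow> real \<Rightarrow> real" where
  "generator P F f = (THE g. generator_graph P F f g)"

definition fourier :: "(real \<Rightarrow> real) \<Rightarrow> real \<Rightarrow> complex" where
  "fourier f \<xi> = complex_of_real (1 / (2 * pi)) *
     (LINT x|lborel. exp (- \<i> * complex_of_real (\<xi> * x)) * complex_of_real (f x))"

definition lk_symbol ::
  "(real \<Rightarrow> real) \<Rightarrow> (real \<Rightarrow> real) \<Rightarrow> (real \<Rightarrow> real) \<Rightarrow> (real \<Rightarrow> real measure) \<Rightarrow> real \<Rightarrow> real \<Rightarrow> complex" where
  "lk_symbol a b c \<nu> x \<xi> =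
     complex_of_real (a x) - \<i> * complex_of_real (\<xi> * b x) + complex_of_real (c x * \<xi>\<^sup>2 / 2)
     - (LINT y|\<nu> x. exp (\<i> * complex_of_real (\<xi> * y)) - 1
          - \<i> * complex_of_real (\<xi> * y * indicator {y. \<bar>y\<bar> \<le> 1} y))"

locale levy_characteristics =
  fixes a b c :: "real \<Rightarrow> real" and \<nu> :: "real \<Rightarrow> real measure"
  assumes measurable_abc: "a \<in> borel_measurable borel" "b \<in> borel_measurable borel" "c \<in> borel_measurable borel"
    and a_nonneg: "\<And>x. a x \<ge> 0"
    and c_nonneg: "\<And>x. c x \<ge> 0"
    and sets_nu: "\<And>x. sets (\<nu> x) = sets borel"
    and kernel_nu: "\<And>B. B \<in> sets borel \<Longrightarrow> (\<lambda>x. emeasure (\<nu> x) B) \<in> borel_measurable borel"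
    and nu_zero: "\<And>x. emeasure (\<nu> x) {0} = 0"
    and nu_levy: "\<And>x. (\<integral>\<^sup>+y. ennreal (min 1 (y\<^sup>2)) \<partial>\<nu> x) < \<infinity>"

definition irreducible_wrt ::
  "(real \<Rightarrow> 'w measure) \<Rightarrow> (real \<Rightarrow> 'w \<Rightarrow> real) \<Rightarrow> real measure \<Rightarrow> bool" where
  "irreducible_wrt P F \<phi> \<longleftrightarrow>
     (\<forall>B\<in>sets borel. emeasure \<phi> B > 0 \<longrightarrow>
        (\<forall>x. (\<integral>\<^sup>+t\<in>{0..}. ennreal (transition P F t x B) \<partial>lborel) > 0))"

text \<open>\<open>absolutely_continuous \<psi> \<phi>\<close> is \<open>\<phi> \<lless> \<psi>\<close>: the dominating measure comes first.\<close>

definition maximal_irreducibility_measure ::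
  "(real \<Rightarrow> 'w measure) \<Rightarrow> (real \<Rightarrow> 'w \<Rightarrow> real) \<Rightarrow> real measure \<Rightarrow> bool" where
  "maximal_irreducibility_measure P F \<psi> \<longleftrightarrow>
     sigma_finite_measure \<psi> \<and> sets \<psi> = sets borel \<and> irreducible_wrt P F \<psi> \<and>
     (\<forall>\<phi>. sigma_finite_measure \<phi> \<and> sets \<phi> = sets borel \<longrightarrow>
        (irreducible_wrt P F \<phi> \<longleftrightarrow> absolutely_continuous \<psi> \<phi>))"

text \<open>
  The maximal irreducibility measure is unique up to equivalence, so it is immaterial
  whether the condition \<open>open_charged\<close> is required of one or of all of them.
  It forces \<open>\<psi>\<close> to be non-zero, so that irreducibility is never the
  trivial irreducibility with respect to the zero measure.
\<close>

locale nice_feller_process =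
  feller_process M P F + levy_characteristics a b c \<nu>
  for M :: "'w measure" and P F a b c \<nu> +
  assumes test_functions_in_domain: "Cc_smooth \<subseteq> generator_domain P F"
    and generator_symbol:
      "\<And>f x. f \<in> Cc_smooth \<Longrightarrow> complex_of_real (generator P F f x) =
         - (LINT \<xi>|lborel. lk_symbol a b c \<nu> x \<xi> * exp (\<i> * complex_of_real (\<xi> * x)) * fourier f \<xi>)"
    and bounded_coefficients:
      "\<exists>C\<ge>0. \<forall>x \<xi>. cmod (lk_symbol a b c \<nu> x \<xi>) \<le> C * (1 + \<xi>\<^sup>2)"
    and conservative: "\<And>x. lk_symbol a b c \<nu> x 0 = 0 \<and> a x = 0"
    and open_charged:
      "\<exists>\<psi>. maximal_irreducibility_measure P F \<psi> \<and> (\<forall>U. open U \<and> U \<noteq> {} \<longrightarrow> emeasure \<psi> U > 0)"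

locale symmetric_nice_feller_process = nice_feller_process M P F a b c \<nu>
  for M :: "'w measure" and P F a b c \<nu> +
  assumes symmetric: "\<And>x \<xi>. lk_symbol a b c \<nu> x \<xi> = complex_of_real (Re (lk_symbol a b c \<nu> x \<xi>))"

definition upper_tail :: "(real \<Rightarrow> real measure) \<Rightarrow> real \<Rightarrow> real \<Rightarrow> ennreal" where
  "upper_tail \<nu> x y = emeasure (\<nu> x) {y<..}"

end

theory Submission
  imports Defs
begin

text \<open>
  Averaging \<open>Re q(x, \<xi>) \<le> C (1 + \<xi>\<^sup>2)\<close> over a bounded range of frequencies bounds
  \<open>\<integral> min 1 y\<^sup>2 \<nu>(x, dy)\<close> uniformly in \<open>x\<close>. Hence the truncated moments
  \<open>I\<^sub>i(x, r) = \<integral>\<^sub>0\<^sup>r y N\<^sub>i(x, y) dy\<close> satisfy \<open>I\<^sub>2(x, r) \<le> A + I\<^sub>1(x, r)\<close>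
  with a constant \<open>A\<close>, and both the supremum and the infimum over \<open>x\<close> inherit this bound.
  Since \<open>N\<^sub>1(x, \<cdot>)\<close> is decreasing, rescaling gives \<open>I\<^sub>1(x, r) \<le> (r/\<rho>)\<^sup>2 I\<^sub>1(x, \<rho>)\<close>, so the
  supremum (infimum) \<open>H\<^sub>1\<close> is either positive at \<open>\<rho>\<close> or zero beyond \<open>\<rho>\<close>. In the first case
  \<open>A\<close> is absorbed into a multiple of \<open>H\<^sub>1\<close>; in the second \<open>H\<^sub>2 \<le> A\<close> is bounded and
  \<open>\<integral> 1/H\<^sub>2\<close> diverges.
\<close>

text \<open>For an upper tail of a measure and \<open>0 \<le> r\<close>, this is half the integral
  of \<open>(min u r)^2\<close> over \<open>u > 0\<close>: a truncated second moment.\<close>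

definition truncated_moment :: "(real \<Rightarrow> ennreal) \<Rightarrow> real \<Rightarrow> ennreal" where
  "truncated_moment N r = (\<integral>\<^sup>+y\<in>{0..r}. ennreal y * N y \<partial>lborel)"

section \<open>Monotone functions with values in \<open>ennreal\<close>\<close>

lemma borel_measurable_mono_ennreal:
  fixes f :: "real \<Rightarrow> ennreal"
  assumes "mono f"
  shows "f \<in> borel_measurable borel"
proof (rule borel_measurableI_greater)
  fix c
  have "is_interval {x. c < f x}"
    unfolding is_interval_1 using assms by (auto simp: mono_def) (meson less_le_trans)
  then show "{x \<in> space borel. c < f x} \<in> sets borel"
    by (simp add: real_interval_borel_measurable)
qed

lemma borel_measurable_antimono_ennreal:
  fixes f :: "real \<Rightarrow> ennreal"
  assumes "antimono f"
  shows "f \<in> borel_measurable borel"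
proof -
  have "(\<lambda>x. f (- x)) \<in> borel_measurable borel"
    using assms by (intro borel_measurable_mono_ennreal) (auto simp: antimono_def mono_def)
  then have "(\<lambda>x. f (- (- x))) \<in> borel_measurable borel"
    by (rule measurable_compose[rotated]) simp
  then show ?thesis by simp
qed

lemma ennreal_inverse_antimono:
  fixes a b :: ennreal
  shows "a \<le> b \<Longrightarrow> inverse b \<le> inverse a"
  including ennreal.lifting by transfer (rule ereal_inverse_antimono)

section \<open>Scaling and comparison of truncated moments\<close>

lemma truncated_moment_mono: "mono (truncated_moment N)"
  unfolding truncated_moment_def
  by (auto intro!: monoI nn_integral_mono simp: indicator_def)

text \<open>The dilation by \<open>k = r / \<rho>\<close> yields one factor \<open>k\<close> from
  the Lebesgue measure and one from the weight \<open>y\<close>, while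
  \<open>N (k * y) \<le> N y\<close> because \<open>k \<ge> 1\<close>. Through this bound a zero at
  \<open>\<rho>\<close> propagates to all larger \<open>r\<close>.\<close>

lemma truncated_moment_scale:
  assumes N: "antimono N" and "0 < \<rho>" "\<rho> \<le> r"
  shows "truncated_moment N r \<le> ennreal ((r / \<rho>)\<^sup>2) * truncated_moment N \<rho>"
proof -
  define k where "k = r / \<rho>"
  have k: "1 \<le> k" "r = k * \<rho>"
    using assms by (auto simp: k_def)
  note [measurable] = borel_measurable_antimono_ennreal[OF N]
  have "truncated_moment N r = \<bar>k\<bar> * (\<integral>\<^sup>+y. ennreal (0 + k * y) * N (0 + k * y) * indicator {0..r} (0 + k * y) \<partial>lborel)"
    unfolding truncated_moment_def using k by (intro nn_integral_real_affine) auto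
  also have "\<dots> \<le> ennreal k * (\<integral>\<^sup>+y. ennreal k * (ennreal y * N y * indicator {0..\<rho>} y) \<partial>lborel)"
  proof (rule mult_mono[OF _ nn_integral_mono])
    fix y :: real
    have "0 \<le> k * y \<longleftrightarrow> 0 \<le> y" "k * y \<le> k * \<rho> \<longleftrightarrow> y \<le> \<rho>"
      using k by (auto simp: zero_le_mult_iff)
    moreover have "N (k * y) \<le> N y" if "0 \<le> y"
      using k that mult_right_mono[of 1 k y] by (intro antimonoD[OF N]) auto
    ultimately show "ennreal (0 + k * y) * N (0 + k * y) * indicator {0..r} (0 + k * y)
        \<le> ennreal k * (ennreal y * N y * indicator {0..\<rho>} y)"
      using k by (auto simp: indicator_def ennreal_mult mult.assoc intro!: mult_left_mono)
  qed (use k in \<open>auto intro!: ennreal_leI\<close>)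
  also have "\<dots> = ennreal (k\<^sup>2) * truncated_moment N \<rho>"
    unfolding truncated_moment_def using k
    by (subst nn_integral_cmult) (auto simp: power2_eq_square ennreal_mult mult.assoc)
  finally show ?thesis unfolding k_def .
qed

lemma truncated_moment_le_add:
  assumes "N2 \<in> borel_measurable borel" and N: "\<And>y. s \<le> y \<Longrightarrow> N2 y \<le> N1 y"
  shows "truncated_moment N2 r \<le> truncated_moment N2 s + truncated_moment N1 r"
proof -
  note [measurable] = assms(1)
  \<comment> \<open>The bound \<open>max 0 s\<close> keeps the second range inside
    \<open>{0..r}\<close> whatever the sign of \<open>s\<close>; the ranges may share the point
    \<open>s\<close>, which an upper bound tolerates.\<close>
  have "truncated_moment N2 r \<le>
      (\<integral>\<^sup>+y. ennreal y * N2 y * indicator {0..s} y + ennreal y * N2 y * indicator {max 0 s..r} y \<partial>lborel)"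
    unfolding truncated_moment_def by (intro nn_integral_mono) (auto simp: indicator_def)
  also have "\<dots> = truncated_moment N2 s + (\<integral>\<^sup>+y\<in>{max 0 s..r}. ennreal y * N2 y \<partial>lborel)"
    unfolding truncated_moment_def by (intro nn_integral_add) auto
  also have "\<dots> \<le> truncated_moment N2 s + truncated_moment N1 r"
    unfolding truncated_moment_def
    by (intro add_left_mono nn_integral_mono) (auto simp: indicator_def intro!: mult_left_mono N)
  finally show ?thesis .
qed

section \<open>Comparison of integrals of reciprocals\<close>

text \<open>
  The first implication of the theorem is used in contrapositive form, so that one transfer
  lemma serves both the supremum and the infimum.
\<close>

lemma inverse_integral_finite_transfer:
  fixes H1 H2 :: "real \<Rightarrow> ennreal"
  assumes H1: "mono H1" and le: "\<And>r. \<rho> \<le> r \<Longrightarrow> H2 r \<le> A + H1 r" and A: "A < \<infinity>"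
    and zero: "\<And>r. \<rho> \<le> r \<Longrightarrow> H1 \<rho> = 0 \<Longrightarrow> H1 r = 0"
    and fin: "(\<integral>\<^sup>+r\<in>{\<rho>..}. inverse (H2 r) \<partial>lborel) < \<infinity>"
  shows "(\<integral>\<^sup>+r\<in>{\<rho>..}. inverse (H1 r) \<partial>lborel) < \<infinity>"
proof -
  note [measurable] = borel_measurable_mono_ennreal[OF H1]
  have "H1 \<rho> \<noteq> 0"
  proof
    assume "H1 \<rho> = 0"
    then have "H2 r \<le> A" if "\<rho> \<le> r" for r
      using le[OF that] zero[OF that] by simp
    then have "(\<integral>\<^sup>+r. inverse A * indicator {\<rho>..} r \<partial>lborel) \<le> (\<integral>\<^sup>+r\<in>{\<rho>..}. inverse (H2 r) \<partial>lborel)"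
      by (intro nn_integral_mono) (auto simp: indicator_def ennreal_inverse_antimono)
    moreover have "emeasure lborel {\<rho>..} = \<infinity>"
    proof (rule ccontr)
      assume "emeasure lborel {\<rho>..} \<noteq> \<infinity>"
      then obtain m where m: "0 \<le> m" "emeasure lborel {\<rho>..} = ennreal m"
        by (cases "emeasure lborel {\<rho>..}") auto
      have "emeasure lborel {\<rho>..\<rho> + (m + 1)} \<le> emeasure lborel {\<rho>..}"
        by (intro emeasure_mono) auto
      then show False
        using m by simp
    qed
    \<comment> \<open>Only \<open>A = \<infinity>\<close> would give inverse zero; for
      \<open>A = 0\<close> the inverse is \<open>\<infinity>\<close>, and the lower bound still
      diverges.\<close>
    moreover have "inverse A \<noteq> 0"
      using A by (simp add: ennreal_inverse_eq_0_iff less_top)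
    ultimately show False
      using fin by (auto simp: nn_integral_cmult_indicator ennreal_mult_top)
  qed
  have "\<exists>k. k < \<infinity> \<and> A \<le> k * H1 \<rho>"
  \<comment> \<open>The quotient \<open>A / H1 \<rho>\<close> fails as a witness at
    \<open>\<infinity>\<close>: it is 0 there, and \<open>0 * \<infinity> = 0\<close> need not
    dominate \<open>A\<close>.\<close>
  proof (cases "H1 \<rho> = \<infinity>")
    case True
    then show ?thesis by (intro exI[of _ 1]) simp
  next
    case False
    with \<open>H1 \<rho> \<noteq> 0\<close> A show ?thesis
      by (intro exI[of _ "A / H1 \<rho>"])
        (auto simp: ennreal_divide_times mult_divide_eq_ennreal ennreal_divide_eq_top_iff simp flip: less_top)
  qed
  then obtain k where k: "k < \<infinity>" "A \<le> k * H1 \<rho>" by blast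
  \<comment> \<open>Monotonicity of \<open>H1\<close> carries the bound at \<open>\<rho>\<close> to
    every \<open>r\<close>. Since \<open>1 + k\<close> is neither 0 nor \<open>\<infinity>\<close>,
    the inverse of the product splits even where \<open>H1 r = \<infinity>\<close>.\<close>
  have "inverse (H1 r) / (1 + k) \<le> inverse (H2 r)" if "\<rho> \<le> r" for r
  proof -
    have "A \<le> k * H1 r"
      using k(2) monoD[OF H1 that] by (meson mult_left_mono order_trans zero_le)
    then have "H2 r \<le> (1 + k) * H1 r"
      using add_right_mono[of A "k * H1 r" "H1 r"] order_trans[OF le[OF that]]
      by (simp add: distrib_right add.commute)
    then have "inverse ((1 + k) * H1 r) \<le> inverse (H2 r)"
      by (rule ennreal_inverse_antimono)
    then show ?thesis
      using k(1) by (simp add: divide_ennreal_def ennreal_inverse_mult' mult.commute add_pos_nonneg)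
  qed
  then have "(\<integral>\<^sup>+r\<in>{\<rho>..}. inverse (H1 r) / (1 + k) \<partial>lborel) \<le> (\<integral>\<^sup>+r\<in>{\<rho>..}. inverse (H2 r) \<partial>lborel)"
    by (intro nn_integral_mono) (auto simp: indicator_def)
  moreover have "(\<integral>\<^sup>+r\<in>{\<rho>..}. inverse (H1 r) / (1 + k) \<partial>lborel)
      = (\<integral>\<^sup>+r\<in>{\<rho>..}. inverse (H1 r) \<partial>lborel) / (1 + k)"
    unfolding divide_ennreal_def by (subst nn_integral_multc[symmetric]) (auto simp: ac_simps)
  ultimately have "(\<integral>\<^sup>+r\<in>{\<rho>..}. inverse (H1 r) \<partial>lborel) / (1 + k) < \<infinity>"
    using fin by simp
  then show ?thesis
    using k(1) by (auto simp: ennreal_divide_eq_top_iff simp flip: less_top)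
qed

section \<open>Levy measures and the real part of the symbol\<close>

context levy_characteristics
begin

lemmas [measurable_cong] = sets_nu

text \<open>The mass may be infinite near 0, but \<open>{0}\<close> is null and Chebyshev's
  inequality makes the mass outside each neighbourhood of 0 finite. This permits the Fubini
  arguments below.\<close>

lemma sigma_finite_nu: "sigma_finite_measure (\<nu> x)"
proof
  define S where "S n = {y::real. 1 / real (Suc n) \<le> \<bar>y\<bar>}" for n
  have S: "emeasure (\<nu> x) (S n) < \<infinity>" for n
  proof -
    have "emeasure (\<nu> x) (S n) = (\<integral>\<^sup>+y. indicator (S n) y \<partial>\<nu> x)"
      by (subst nn_integral_indicator) (auto simp: S_def)
    also have "\<dots> \<le> (\<integral>\<^sup>+y. ennreal ((real (Suc n))\<^sup>2) * ennreal (min 1 (y\<^sup>2)) \<partial>\<nu> x)"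
    proof (intro nn_integral_mono)
      fix y
      have "1 \<le> (real (Suc n))\<^sup>2 * min 1 (y\<^sup>2)" if "1 / real (Suc n) \<le> \<bar>y\<bar>"
      proof -
        have "1 \<le> real (Suc n) * \<bar>y\<bar>"
          using that by (simp add: field_simps)
        then have "1 \<le> (real (Suc n) * \<bar>y\<bar>)\<^sup>2"
          by (simp add: one_le_power)
        then show ?thesis
          by (auto simp: min_def power_mult_distrib)
      qed
      then show "indicator (S n) y \<le> ennreal ((real (Suc n))\<^sup>2) * ennreal (min 1 (y\<^sup>2))"
        by (auto simp: S_def indicator_def ennreal_mult[symmetric] simp del: of_nat_Suc)
    qed
    also have "\<dots> < \<infinity>"
      using nu_levy[of x] by (subst nn_integral_cmult) (auto simp: ennreal_mult_less_top)
    finally show ?thesis .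
  qed
  have cov: "{0} \<union> (\<Union>n. S n) = UNIV"
  proof -
    have "y \<in> (\<Union>n. S n)" if "y \<noteq> 0" for y
      using reals_Archimedean[of "\<bar>y\<bar>"] that by (auto simp: S_def inverse_eq_divide intro: less_imp_le)
    then show ?thesis by blast
  qed
  have sp: "space (\<nu> x) = UNIV"
    using sets_eq_imp_space_eq[OF sets_nu] by simp
  show "\<exists>A. countable A \<and> A \<subseteq> sets (\<nu> x) \<and> \<Union>A = space (\<nu> x) \<and> (\<forall>a\<in>A. emeasure (\<nu> x) a \<noteq> \<infinity>)"
    using S cov nu_zero[of x]
    by (intro exI[of _ "insert {0} (range S)"]) (auto simp: sets_nu sp S_def less_top)
qed

lemma integrable_min_nu: "integrable (\<nu> x) (\<lambda>y. min 1 (y\<^sup>2))"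
  using nu_levy[of x] by (intro integrableI_bounded) auto

text \<open>For \<open>\<bar>y\<bar> \<le> 1\<close> the compensator leaves a second-order Taylor
  remainder; beyond 1 it is absent and the modulus is at most 2. The constant
  \<open>2 + \<xi>^2\<close> covers both ranges.\<close>

lemma integrable_lk_integrand:
  "integrable (\<nu> x) (\<lambda>y. exp (\<i> * complex_of_real (\<xi> * y)) - 1
     - \<i> * complex_of_real (\<xi> * y * indicator {y. \<bar>y\<bar> \<le> 1} y))" (is "integrable _ ?g")
proof (rule Bochner_Integration.integrable_bound)
  show "integrable (\<nu> x) (\<lambda>y. (2 + \<xi>\<^sup>2) * min 1 (y\<^sup>2))"
    by (intro integrable_mult_right integrable_min_nu)
  show "?g \<in> borel_measurable (\<nu> x)"
    by measurable
  have "cmod (?g y) \<le> (2 + \<xi>\<^sup>2) * min 1 (y\<^sup>2)" for y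
  proof (cases "\<bar>y\<bar> \<le> 1")
    case True
    then have "y\<^sup>2 \<le> 1"
      by (simp add: abs_square_le_1)
    moreover have "cmod (?g y) \<le> \<xi>\<^sup>2 * y\<^sup>2 / 2"
      using iexp_approx1[of "\<xi> * y" 1] True
      by (simp add: diff_diff_eq power_mult_distrib power2_abs flip: power2_eq_square abs_mult)
    ultimately show ?thesis
      using zero_le_power2[of y] mult_nonneg_nonneg[OF zero_le_power2[of \<xi>] zero_le_power2[of y]]
      unfolding min_absorb2[OF \<open>y\<^sup>2 \<le> 1\<close>] distrib_right by linarith
  next
    case False
    then have "1 \<le> y\<^sup>2"
      using one_le_power[of "\<bar>y\<bar>" 2] by simp
    moreover have "cmod (exp (\<i> * complex_of_real (\<xi> * y)) - 1) \<le> 2"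
      using norm_triangle_ineq4[of "exp (\<i> * complex_of_real (\<xi> * y))" 1] by simp
    ultimately show ?thesis
      using False by (simp add: add_increasing2)
  qed
  then show "AE y in \<nu> x. norm (?g y) \<le> norm ((2 + \<xi>\<^sup>2) * min 1 (y\<^sup>2))"
    by (intro AE_I2) (simp add: order_trans[OF _ abs_ge_self])
qed

lemma nn_integral_one_minus_cos_le:
  "(\<integral>\<^sup>+y. ennreal (1 - cos (\<xi> * y)) \<partial>\<nu> x) \<le> ennreal (cmod (lk_symbol a b c \<nu> x \<xi>))"
proof -
  let ?g = "\<lambda>y. exp (\<i> * complex_of_real (\<xi> * y)) - 1
     - \<i> * complex_of_real (\<xi> * y * indicator {y. \<bar>y\<bar> \<le> 1} y)"
  \<comment> \<open>Integrability of the integrand matters: otherwise the integral in the symbol would be the junk value 0.\<close>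
  have Re: "- Re (?g y) = 1 - cos (\<xi> * y)" for y
    by (simp add: Re_exp)
  have int: "integrable (\<nu> x) (\<lambda>y. 1 - cos (\<xi> * y))"
    using integrable_minus[OF integrable_Re[OF integrable_lk_integrand[of x \<xi>]]] unfolding Re .
  have "(LINT y|\<nu> x. 1 - cos (\<xi> * y)) = - (LINT y|\<nu> x. Re (?g y))"
    unfolding Re[symmetric] by (rule integral_minus)
  also have "\<dots> = - Re (LINT y|\<nu> x. ?g y)"
    by (subst integral_Re[OF integrable_lk_integrand]) simp
  also have "\<dots> \<le> Re (lk_symbol a b c \<nu> x \<xi>)"
    using a_nonneg[of x] c_nonneg[of x] by (simp add: lk_symbol_def)
  also have "\<dots> \<le> cmod (lk_symbol a b c \<nu> x \<xi>)"
    by (rule complex_Re_le_cmod)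
  finally show ?thesis
    using int by (subst nn_integral_eq_integral) (auto intro!: ennreal_leI)
qed

text \<open>Writing the tail as an integral over \<open>u > y\<close> and exchanging the integrals
  leaves, for each \<open>u\<close>, an integral of \<open>y\<close> over a range of length at most
  \<open>min \<bar>u\<bar> r\<close>.\<close>

lemma truncated_moment_upper_tail_le:
  assumes "0 \<le> r"
  shows "truncated_moment (upper_tail \<nu> x) r
    \<le> ennreal (1 + r\<^sup>2) * (\<integral>\<^sup>+u. ennreal (min 1 (u\<^sup>2)) \<partial>\<nu> x)"
proof -
  interpret sigma_finite_measure "\<nu> x" by (rule sigma_finite_nu)
  interpret pair_sigma_finite lborel "\<nu> x" ..
  define h where "h y u = ennreal y * indicator {0..r} y * (if y < u then 1 else 0)" for y u :: real
  have [measurable]: "case_prod h \<in> borel_measurable (lborel \<Otimes>\<^sub>M \<nu> x)"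
    unfolding h_def by measurable
  have "truncated_moment (upper_tail \<nu> x) r = (\<integral>\<^sup>+y. (\<integral>\<^sup>+u. h y u \<partial>\<nu> x) \<partial>lborel)"
    unfolding truncated_moment_def
  proof (intro nn_integral_cong)
    fix y
    have "(\<integral>\<^sup>+u. h y u \<partial>\<nu> x) = (\<integral>\<^sup>+u. (ennreal y * indicator {0..r} y) * indicator {y<..} u \<partial>\<nu> x)"
      by (intro nn_integral_cong) (simp add: h_def indicator_def)
    also have "\<dots> = ennreal y * indicator {0..r} y * upper_tail \<nu> x y"
      by (subst nn_integral_cmult_indicator) (auto simp: upper_tail_def sets_nu)
    finally show "ennreal y * upper_tail \<nu> x y * indicator {0..r} y = (\<integral>\<^sup>+u. h y u \<partial>\<nu> x)"
      by (simp add: ac_simps)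
  qed
  also have "\<dots> = (\<integral>\<^sup>+u. (\<integral>\<^sup>+y. h y u \<partial>lborel) \<partial>\<nu> x)"
    by (rule Fubini'[symmetric]) measurable
  also have "\<dots> \<le> (\<integral>\<^sup>+u. ennreal (1 + r\<^sup>2) * ennreal (min 1 (u\<^sup>2)) \<partial>\<nu> x)"
  proof (intro nn_integral_mono)
    fix u
    define m where "m = min \<bar>u\<bar> r"
    have m: "0 \<le> m" using assms by (simp add: m_def)
    \<comment> \<open>Where \<open>h y u\<close> is nonzero, \<open>0 \<le> y < u\<close> and
      \<open>y \<le> r\<close>, so \<open>y \<le> m\<close>; for negative \<open>u\<close> it
      vanishes identically.\<close>
    have "(\<integral>\<^sup>+y. h y u \<partial>lborel) \<le> (\<integral>\<^sup>+y. ennreal m * indicator {0..m} y \<partial>lborel)"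
      by (intro nn_integral_mono) (auto simp: h_def indicator_def m_def intro!: ennreal_leI)
    also have "\<dots> = ennreal (m\<^sup>2)"
      using m by (simp add: nn_integral_cmult_indicator ennreal_mult power2_eq_square)
    also have "\<dots> \<le> ennreal ((1 + r\<^sup>2) * min 1 (u\<^sup>2))"
    proof (intro ennreal_leI)
      have "m\<^sup>2 \<le> u\<^sup>2" "m\<^sup>2 \<le> r\<^sup>2"
        using m power_mono[of m "\<bar>u\<bar>" 2] power_mono[of m r 2] by (auto simp: m_def)
      then show "m\<^sup>2 \<le> (1 + r\<^sup>2) * min 1 (u\<^sup>2)"
        by (auto simp: min_def algebra_simps intro: add_increasing2)
    qed
    finally show "(\<integral>\<^sup>+y. h y u \<partial>lborel) \<le> ennreal (1 + r\<^sup>2) * ennreal (min 1 (u\<^sup>2))"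
      by (simp add: ennreal_mult)
  qed
  also have "\<dots> = ennreal (1 + r\<^sup>2) * (\<integral>\<^sup>+u. ennreal (min 1 (u\<^sup>2)) \<partial>\<nu> x)"
    by (rule nn_integral_cmult) measurable
  finally show ?thesis .
qed

lemma antimono_upper_tail: "antimono (upper_tail \<nu> x)"
  unfolding upper_tail_def by (auto intro!: antimonoI emeasure_mono simp: sets_nu)

end

section \<open>Uniform bound on the Levy mass from the symbol\<close>

text \<open>
  No finite set of frequencies bounds the tail of \<open>\<nu>\<close> because \<open>1 - cos (\<xi> y)\<close> vanishes
  periodically; the average over \<open>\<xi> \<in> [0, 2]\<close> does, as \<open>2 - sin (2 y) / y \<ge> 1\<close> for \<open>\<bar>y\<bar> \<ge> 1\<close>.
\<close>

lemma min_one_square_le: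
  fixes y :: real
  shows "ennreal (min 1 (y\<^sup>2)) \<le> 3 * ennreal (1 - cos y) + (\<integral>\<^sup>+\<xi>\<in>{0..2}. ennreal (1 - cos (\<xi> * y)) \<partial>lborel)"
proof (cases "\<bar>y\<bar> \<le> 1")
  case True
  then have y: "y\<^sup>2 \<le> 1"
    by (simp add: abs_square_le_1)
  \<comment> \<open>The cubic Taylor polynomial has real part \<open>1 - y^2 / 2\<close>. With
    remainder at most \<open>y^2 / 24\<close> this gives \<open>1 - cos y \<ge> 11/24 * y^2\<close>,
    so the factor 3 is ample.\<close>
  have "\<bar>Re (iexp y - (\<Sum>k\<le>3. (\<i> * y)^k / fact k))\<bar> \<le> y^4 / 24"
    using order_trans[OF abs_Re_le_cmod iexp_approx1[of y 3]] by (simp add: fact_numeral)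
  then have "\<bar>cos y - (1 - y\<^sup>2 / 2)\<bar> \<le> y^4 / 24"
    by (simp add: Re_exp numeral_3_eq_3 power2_eq_square fact_numeral)
  moreover have "y^4 \<le> y\<^sup>2"
    using y mult_left_mono[of "y\<^sup>2" 1 "y\<^sup>2"] by (simp add: power4_eq_xxxx power2_eq_square mult.assoc)
  ultimately have "y\<^sup>2 \<le> 3 * (1 - cos y)"
    using zero_le_power2[of y] by (simp only: abs_le_iff) argo
  then have "min 1 (y\<^sup>2) \<le> 3 * (1 - cos y)"
    by simp
  then have "ennreal (min 1 (y\<^sup>2)) \<le> ennreal (3 * (1 - cos y))"
    by (rule ennreal_leI)
  also have "\<dots> = 3 * ennreal (1 - cos y)"
    by (subst ennreal_mult) auto
  finally show ?thesis
    by (simp add: add_increasing2)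
next
  case False
  have "(\<integral>\<^sup>+\<xi>. ennreal (1 - cos (\<xi> * y)) * indicator {0..2} \<xi> \<partial>lborel)
      = ennreal ((2 - sin (2 * y) / y) - (0 - sin (0 * y) / y))"
    using False by (intro nn_integral_FTC_Icc) (auto intro!: derivative_eq_intros)
  moreover have "sin (2 * y) / y \<le> 1"
  proof -
    have "\<bar>sin (2 * y) / y\<bar> \<le> 1"
      using False abs_sin_le_one[of "2 * y"] unfolding abs_divide
      by (subst pos_divide_le_eq) linarith+
    then show ?thesis
      by (rule order_trans[OF abs_ge_self])
  qed
  ultimately have "1 \<le> (\<integral>\<^sup>+\<xi>\<in>{0..2}. ennreal (1 - cos (\<xi> * y)) \<partial>lborel)"
    by simp
  moreover have "ennreal (min 1 (y\<^sup>2)) \<le> 1"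
    by simp
  ultimately show ?thesis
    by (meson add_increasing order_trans zero_le)
qed

text \<open>The constant is \<open>16 = 3 * 2 + 2 * 5\<close>: the frequency 1 contributes
  \<open>2 * C\<close> three times, and on the interval \<open>{0..2}\<close> of length 2 the symbol
  is at most \<open>5 * C\<close>.\<close>

lemma (in levy_characteristics) levy_mass_le:
  assumes C: "0 \<le> C" "\<And>\<xi>. cmod (lk_symbol a b c \<nu> x \<xi>) \<le> C * (1 + \<xi>\<^sup>2)"
  shows "(\<integral>\<^sup>+y. ennreal (min 1 (y\<^sup>2)) \<partial>\<nu> x) \<le> ennreal (16 * C)"
proof -
  interpret sigma_finite_measure "\<nu> x" by (rule sigma_finite_nu)
  interpret pair_sigma_finite lborel "\<nu> x" ..
  have cos_le: "(\<integral>\<^sup>+y. ennreal (1 - cos (\<xi> * y)) \<partial>\<nu> x) \<le> ennreal (C * (1 + \<xi>\<^sup>2))" for \<xi>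
    using nn_integral_one_minus_cos_le ennreal_leI[OF C(2)[of \<xi>]] by (rule order_trans)
  have "(\<integral>\<^sup>+y. (\<integral>\<^sup>+\<xi>\<in>{0..2}. ennreal (1 - cos (\<xi> * y)) \<partial>lborel) \<partial>\<nu> x)
      = (\<integral>\<^sup>+\<xi>. (\<integral>\<^sup>+y. ennreal (1 - cos (\<xi> * y)) * indicator {0..2} \<xi> \<partial>\<nu> x) \<partial>lborel)"
    by (rule Fubini') measurable
  also have "\<dots> \<le> (\<integral>\<^sup>+\<xi>. ennreal (5 * C) * indicator {0..2::real} \<xi> \<partial>lborel)"
  proof (intro nn_integral_mono)
    fix \<xi> :: real
    have "C * (1 + \<xi>\<^sup>2) \<le> 5 * C" if "0 \<le> \<xi>" "\<xi> \<le> 2"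
      using C(1) power_mono[of \<xi> 2 2] that by (subst mult.commute) (auto intro!: mult_right_mono)
    then show "(\<integral>\<^sup>+y. ennreal (1 - cos (\<xi> * y)) * indicator {0..2} \<xi> \<partial>\<nu> x) \<le> ennreal (5 * C) * indicator {0..2} \<xi>"
      using cos_le[of \<xi>] by (auto simp: indicator_def intro: order_trans ennreal_leI)
  qed
  also have "\<dots> = ennreal (10 * C)"
  proof -
    have "ennreal (5 * C) * ennreal 2 = ennreal (10 * C)"
      using C(1) by (subst ennreal_mult[symmetric]) auto
    then show ?thesis
      by (simp add: nn_integral_cmult_indicator)
  qed
  finally have avg: "(\<integral>\<^sup>+y. (\<integral>\<^sup>+\<xi>\<in>{0..2}. ennreal (1 - cos (\<xi> * y)) \<partial>lborel) \<partial>\<nu> x) \<le> ennreal (10 * C)" .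
  have "(\<integral>\<^sup>+y. ennreal (min 1 (y\<^sup>2)) \<partial>\<nu> x) \<le>
      (\<integral>\<^sup>+y. 3 * ennreal (1 - cos y) + (\<integral>\<^sup>+\<xi>\<in>{0..2}. ennreal (1 - cos (\<xi> * y)) \<partial>lborel) \<partial>\<nu> x)"
    by (intro nn_integral_mono min_one_square_le)
  also have "\<dots> = 3 * (\<integral>\<^sup>+y. ennreal (1 - cos y) \<partial>\<nu> x)
      + (\<integral>\<^sup>+y. (\<integral>\<^sup>+\<xi>\<in>{0..2}. ennreal (1 - cos (\<xi> * y)) \<partial>lborel) \<partial>\<nu> x)"
    by (subst nn_integral_add) (auto simp: nn_integral_cmult)
  also have "\<dots> \<le> 3 * ennreal (2 * C) + ennreal (10 * C)"
    using cos_le[of 1] by (intro add_mono mult_left_mono avg) (auto simp: mult.commute)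
  also have "\<dots> = ennreal (16 * C)"
  proof -
    have "3 * ennreal (2 * C) = ennreal (6 * C)"
      using C(1) ennreal_mult[of 3 "2 * C"] by simp
    then show ?thesis
      using C(1) by (simp flip: ennreal_plus)
  qed
  finally show ?thesis .
qed

text \<open>Here the growth bound on the symbol enters; being uniform in \<open>x\<close>, it yields
  the finite constant of the comparison.\<close>

lemma (in nice_feller_process) truncated_moment_upper_tail_bounded:
  assumes "0 \<le> r"
  shows "(SUP x. truncated_moment (upper_tail \<nu> x) r) < \<infinity>"
proof -
  obtain C where C: "C \<ge> 0" "\<And>x \<xi>. cmod (lk_symbol a b c \<nu> x \<xi>) \<le> C * (1 + \<xi>\<^sup>2)"
    using bounded_coefficients by blast
  have "truncated_moment (upper_tail \<nu> x) r \<le> ennreal (1 + r\<^sup>2) * ennreal (16 * C)" for x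
    using truncated_moment_upper_tail_le[OF assms, of x] levy_mass_le[OF C, of x]
    by (meson mult_left_mono order_trans zero_le)
  then have "(SUP x. truncated_moment (upper_tail \<nu> x) r) \<le> ennreal (1 + r\<^sup>2) * ennreal (16 * C)"
    by (rule SUP_least)
  also have "\<dots> < \<infinity>"
    by (simp add: ennreal_mult_less_top)
  finally show ?thesis .
qed

section \<open>Comparison of the two processes\<close>

theorem theorem3p12:
  fixes M1 :: "'w1 measure" and P1 :: "real \<Rightarrow> 'w1 measure" and F1 :: "real \<Rightarrow> 'w1 \<Rightarrow> real"
    and M2 :: "'w2 measure" and P2 :: "real \<Rightarrow> 'w2 measure" and F2 :: "real \<Rightarrow> 'w2 \<Rightarrow> real"
    and a1 b1 c1 a2 b2 c2 :: "real \<Rightarrow> real"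
    and \<nu>1 \<nu>2 :: "real \<Rightarrow> real measure"
    and N1 N2 :: "real \<Rightarrow> real \<Rightarrow> ennreal"
  defines "N1 \<equiv> upper_tail \<nu>1" and "N2 \<equiv> upper_tail \<nu>2"
  assumes process1: "symmetric_nice_feller_process M1 P1 F1 a1 b1 c1 \<nu>1"
    and process2: "symmetric_nice_feller_process M2 P2 F2 a2 b2 c2 \<nu>2"
    and bigger_tail: "\<exists>y1>0. \<forall>x. \<forall>y\<ge>y1. N1 x y \<ge> N2 x y"
  shows "(\<forall>\<rho>>0.
            (\<integral>\<^sup>+r\<in>{\<rho>..}. inverse (SUP x. \<integral>\<^sup>+y\<in>{0..r}. ennreal y * N1 x y \<partial>lborel) \<partial>lborel) = \<infinity> \<longrightarrow>
            (\<integral>\<^sup>+r\<in>{\<rho>..}. inverse (SUP x. \<integral>\<^sup>+y\<in>{0..r}. ennreal y * N2 x y \<partial>lborel) \<partial>lborel) = \<infinity>)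
       \<and> ((\<exists>y0>0. (INF x. \<integral>\<^sup>+y\<in>{y0..}. ennreal y * N1 x y \<partial>lborel) > 0) \<longrightarrow>
          (\<forall>\<rho>>0.
            (\<integral>\<^sup>+r\<in>{\<rho>..}. inverse (INF x. \<integral>\<^sup>+y\<in>{0..r}. ennreal y * N2 x y \<partial>lborel) \<partial>lborel) < \<infinity> \<longrightarrow>
            (\<integral>\<^sup>+r\<in>{\<rho>..}. inverse (INF x. \<integral>\<^sup>+y\<in>{0..r}. ennreal y * N1 x y \<partial>lborel) \<partial>lborel) < \<infinity>))"
proof -
  interpret p1: symmetric_nice_feller_process M1 P1 F1 a1 b1 c1 \<nu>1 by (rule process1)
  interpret p2: symmetric_nice_feller_process M2 P2 F2 a2 b2 c2 \<nu>2 by (rule process2)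
  obtain y1 where y1: "0 < y1" "\<And>x y. y1 \<le> y \<Longrightarrow> N2 x y \<le> N1 x y"
    using bigger_tail by blast
  have anti: "antimono (N1 x)" "antimono (N2 x)" for x
    unfolding N1_def N2_def by (rule p1.antimono_upper_tail p2.antimono_upper_tail)+
  \<comment> \<open>This absorbs the contribution of \<open>y \<le> y1\<close>, where the tails are
    not compared.\<close>
  define A where "A = (SUP x. truncated_moment (N2 x) y1)"
  have A: "A < \<infinity>"
    unfolding A_def N2_def using y1(1) by (intro p2.truncated_moment_upper_tail_bounded) simp
  have le: "truncated_moment (N2 x) r \<le> A + truncated_moment (N1 x) r" for x r
  proof -
    have "truncated_moment (N2 x) r \<le> truncated_moment (N2 x) y1 + truncated_moment (N1 x) r"
      by (intro truncated_moment_le_add borel_measurable_antimono_ennreal anti y1(2))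
    also have "\<dots> \<le> A + truncated_moment (N1 x) r"
      unfolding A_def by (intro add_right_mono SUP_upper) simp
    finally show ?thesis .
  qed
  have sup_transfer: "(\<integral>\<^sup>+r\<in>{\<rho>..}. inverse (SUP x. truncated_moment (N1 x) r) \<partial>lborel) < \<infinity>"
    if "0 < \<rho>" and fin: "(\<integral>\<^sup>+r\<in>{\<rho>..}. inverse (SUP x. truncated_moment (N2 x) r) \<partial>lborel) < \<infinity>" for \<rho>
  proof (rule inverse_integral_finite_transfer[OF _ _ A _ fin])
    show "mono (\<lambda>r. SUP x. truncated_moment (N1 x) r)"
      by (intro monoI SUP_mono' monoD[OF truncated_moment_mono])
    show "(SUP x. truncated_moment (N2 x) r) \<le> A + (SUP x. truncated_moment (N1 x) r)" for r
      by (intro SUP_least order_trans[OF le] add_left_mono SUP_upper) simp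
    show "(SUP x. truncated_moment (N1 x) r) = 0"
      if "\<rho> \<le> r" and "(SUP x. truncated_moment (N1 x) \<rho>) = 0" for r
    proof -
      have "truncated_moment (N1 x) r \<le> 0" for x
      proof -
        have "truncated_moment (N1 x) \<rho> \<le> 0"
          unfolding that(2)[symmetric] by (rule SUP_upper) simp
        then show ?thesis
          using truncated_moment_scale[OF anti(1) \<open>0 < \<rho>\<close> that(1), of x] by simp
      qed
      then have "(SUP x. truncated_moment (N1 x) r) \<le> 0"
        by (rule SUP_least)
      then show ?thesis
        by simp
    qed
  qed
  have inf_transfer: "(\<integral>\<^sup>+r\<in>{\<rho>..}. inverse (INF x. truncated_moment (N1 x) r) \<partial>lborel) < \<infinity>"
    if "0 < \<rho>" and fin: "(\<integral>\<^sup>+r\<in>{\<rho>..}. inverse (INF x. truncated_moment (N2 x) r) \<partial>lborel) < \<infinity>" for \<rho>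
  proof (rule inverse_integral_finite_transfer[OF _ _ A _ fin])
    show "mono (\<lambda>r. INF x. truncated_moment (N1 x) r)"
      by (intro monoI INF_mono' monoD[OF truncated_moment_mono])
    show "(INF x. truncated_moment (N2 x) r) \<le> A + (INF x. truncated_moment (N1 x) r)" for r
    proof -
      \<comment> \<open>Subtracting the finite \<open>A\<close> first isolates the moment of
        \<open>N1 x\<close>, so that the infimum over \<open>x\<close> can be taken on the
        right.\<close>
      have "(INF x. truncated_moment (N2 x) r) - A \<le> (INF x. truncated_moment (N1 x) r)"
        using le A by (intro INF_greatest) (auto simp: ennreal_minus_le_iff intro: order_trans[OF INF_lower])
      then show ?thesis
        using A by (simp add: ennreal_minus_le_iff)
    qed
    show "(INF x. truncated_moment (N1 x) r) = 0"
      if "\<rho> \<le> r" and "(INF x. truncated_moment (N1 x) \<rho>) = 0" for r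
    proof -
      \<comment> \<open>A zero infimum need not be attained, so no single moment can be assumed to
        vanish, unlike for the supremum. Instead the scaling bound, divided by \<open>k\<close>, is
        passed to the infimum at \<open>\<rho>\<close>.\<close>
      define k where "k = (r / \<rho>)\<^sup>2"
      have k: "0 < k" using that \<open>0 < \<rho>\<close> by (simp add: k_def)
      have "ennreal (1 / k) * (INF x. truncated_moment (N1 x) r) \<le> (INF x. truncated_moment (N1 x) \<rho>)"
      proof (rule INF_greatest)
        fix x
        have "ennreal (1 / k) * (INF x. truncated_moment (N1 x) r) \<le> ennreal (1 / k) * truncated_moment (N1 x) r"
          by (intro mult_left_mono INF_lower) auto
        also have "\<dots> \<le> ennreal (1 / k) * (ennreal k * truncated_moment (N1 x) \<rho>)"
          unfolding k_def by (intro mult_left_mono truncated_moment_scale anti that \<open>0 < \<rho>\<close>) auto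
        also have "\<dots> = truncated_moment (N1 x) \<rho>"
          using k by (simp flip: mult.assoc ennreal_mult)
        finally show "ennreal (1 / k) * (INF x. truncated_moment (N1 x) r) \<le> truncated_moment (N1 x) \<rho>" .
      qed
      then show ?thesis
        using that(2) k by (simp add: ennreal_eq_0_iff)
    qed
  qed
  show ?thesis
    using sup_transfer inf_transfer
    unfolding truncated_moment_def infinity_ennreal_def less_top[symmetric] by blast
qed

end
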